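(* Let $S$ be a semigroup, let $\sigma:S\to S$ be an involutive automorphism, and let $\mu:S\to\mathbb{C}$ be a multiplicative function such that $\mu(x\sigma(x))=1$ for all $x\in S$. The solutions $k,l:S\to\mathbb{C}$ with $k\neq 0$ of the functional equation $$\mu(y)\,k(x\sigma(y))=k(x)l(y)-k(y)l(x),\qquad x,y\in S, \qquad (\ast)$$ are the following pairs: (1) $k$ is any non-zero function such that $k=0$ on $S^2$, and $l=ck$, where $c\in\mathbb{C}$ is a constant. (2) $$k=c_1\frac{\chi-\chi^*}{2}\quad\text{and}\quad l=\frac{\chi+\chi^*}{2}+c_2\frac{\chi-\chi^*}{2},$$ where $\chi:S\to\mathbb{C}$ is a multiplicative function such that $\chi^*\neq\chi$, and $c_1\in\mathbb{C}\setminus\{0\}$, $c_2\in\mathbb{C}$ are constants. (3) $$k=\begin{cases}\chi A & \text{on } S\setminus I_\chi\\ 0 & \text{on } I_\chi\setminus P_\chi\\ \rho & \text{on } P_\chi\end{cases}\quad\text{and}\quad l=\begin{cases}\chi(1+cA) & \text{on } S\setminus I_\chi\\ 0 & \text{on } I_\chi\setminus P_\chi\\ c\rho & \text{on } P_\chi,\end{cases}$$ where $c\in\mathbb{C}$ is a constant, $\chi:S\to\mathbb{C}$ is a non-zero multiplicative function and $A:S\setminus I_\chi\to\mathbb{C}$ is a non-zero additive function such that $\chi^*=\chi$ and $A\circ\sigma=-A$, and $\rho:P_\chi\to\mathbb{C}$ is the restriction of $k$ to $P_\chi$, such that $\rho^*=-\rho$. In addition (in this case) the following conditions hold: (I) If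 $x\in\{up,pv,upv\}$ for $p\in P_\chi$ and $u,v\in S\setminus I_\chi$, then $x\in P_\chi$ and we have respectively $\rho(x)=\rho(p)\chi(u)$, $\rho(x)=\rho(p)\chi(v)$, or $\rho(x)=\rho(p)\chi(uv)$. (II) $k(xy)=k(yx)=0$ for all $x\in S\setminus I_\chi$ and $y\in I_\chi\setminus P_\chi$. That is, every solution $(k,l)$ of $(\ast)$ with $k\neq0$ has one of the forms (1), (2), or (3) (the latter with (I) and (II) holding). Conversely, if $(k,l)$ is given by the formulas in (1), (2), or (3) with conditions (I) and (II) holding, and if $k$ is abelian in case (3), then $(k,l)$ satisfies $(\ast)$. Furthermore, if $S$ is a topological semigroup and $k\in C(S)$, then (for the functions $\chi,\chi^*,A,\rho$ occurring in the corresponding form) $\chi,\chi^*\in C(S)$, $A\in C(S\setminus I_\chi)$, and $\rho\in C(P_\chi)$.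
   Context: An involutive automorphism of a semigroup $S$ is a map $\sigma:S\to S$ with $\sigma(xy)=\sigma(x)\sigma(y)$ and $\sigma(\sigma(x))=x$ for all $x,y\in S$. A function $\chi:S\to\mathbb{C}$ is multiplicative if $\chi(xy)=\chi(x)\chi(y)$ for all $x,y\in S$. A function $A$ from a semigroup $T$ to $\mathbb{C}$ is additive if $A(xy)=A(x)+A(y)$ for all $x,y\in T$. A function $f:S\to\mathbb{C}$ is central if $f(xy)=f(yx)$ for all $x,y\in S$; it is abelian if it is central and $f(xyz)=f(xzy)$ for all $x,y,z\in S$. For $T\subseteq S$, $T^2:=\{xy\mid x,y\in T\}$. For a function $f$ on $S$, $f^*(x):=\mu(x)f(\sigma(x))$; the same formula is used for $\rho^*$ on $P_\chi$ (when $\chi^*=\chi$, $\sigma$ maps $P_\chi$ onto itself). For a non-zero multiplicative function $\chi:S\to\mathbb{C}$, set $$I_\chi:=\{x\in S\mid \chi(x)=0\},$$ $$P_\chi:=\{p\in I_\chi\setminus I_\chi^2\mid up,\,pv,\,upv\in I_\chi\setminus I_\chi^2\ \text{for all}\ u,v\in S\setminus I_\chi\}.$$ The set $S\setminus I_\chi$ is a subsemigroup of $S$. For a topological space $X$, $C(X)$ denotes the set of continuous functions from $X$ to $\mathbb{C}$; subsets of $S$ carry the subspace topology.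
   Formalization: In case (3), the requirement that A be a non-zero additive function is replaced by: A is non-zero on S∖I_χ or ρ is non-zero on P_χ (that is, k≠0), since solutions with A=0 and ρ≠0 exist. *)

theory Defs
  imports "HOL-Analysis.Analysis"
begin

text \<open>
  A semigroup \<open>S\<close> is a type of class \<^class>\<open>semigroup_mult\<close>. Functions defined only on a subset
  of \<open>S\<close> (such as \<open>A\<close> and \<open>\<rho>\<close> below) are total functions of which only the values on
  that subset are ever used.
\<close>

definition involutive_automorphism :: "('a::semigroup_mult \<Rightarrow> 'a) \<Rightarrow> bool" where
  "involutive_automorphism \<sigma> \<longleftrightarrow> (\<forall>x y. \<sigma> (x * y) = \<sigma> x * \<sigma> y) \<and> (\<forall>x. \<sigma> (\<sigma> x) = x)"

definition multiplicative :: "('a::semigroup_mult \<Rightarrow> complex) \<Rightarrow> bool" where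
  "multiplicative chi \<longleftrightarrow> (\<forall>x y. chi (x * y) = chi x * chi y)"

definition additive_on :: "'a::semigroup_mult set \<Rightarrow> ('a \<Rightarrow> complex) \<Rightarrow> bool" where
  "additive_on T A \<longleftrightarrow> (\<forall>x\<in>T. \<forall>y\<in>T. A (x * y) = A x + A y)"

definition central_fun :: "('a::semigroup_mult \<Rightarrow> complex) \<Rightarrow> bool" where
  "central_fun f \<longleftrightarrow> (\<forall>x y. f (x * y) = f (y * x))"

definition abelian_fun :: "('a::semigroup_mult \<Rightarrow> complex) \<Rightarrow> bool" where
  "abelian_fun f \<longleftrightarrow> central_fun f \<and> (\<forall>x y z. f (x * y * z) = f (x * z * y))"

definition set_square :: "'a::semigroup_mult set \<Rightarrow> 'a set" where
  "set_square T = {x * y | x y. x \<in> T \<and> y \<in> T}"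

definition star :: "('a \<Rightarrow> complex) \<Rightarrow> ('a \<Rightarrow> 'a) \<Rightarrow> ('a \<Rightarrow> complex) \<Rightarrow> 'a \<Rightarrow> complex" where
  "star \<mu> \<sigma> f = (\<lambda>x. \<mu> x * f (\<sigma> x))"

definition null_ideal :: "('a \<Rightarrow> complex) \<Rightarrow> 'a set" where
  "null_ideal chi = {x. chi x = 0}"

definition P_set :: "('a::semigroup_mult \<Rightarrow> complex) \<Rightarrow> 'a set" where
  "P_set chi = {p. p \<in> null_ideal chi - set_square (null_ideal chi) \<and>
     (\<forall>u \<in> - null_ideal chi. \<forall>v \<in> - null_ideal chi.
        u * p \<in> null_ideal chi - set_square (null_ideal chi) \<and>
        p * v \<in> null_ideal chi - set_square (null_ideal chi) \<and>
        u * p * v \<in> null_ideal chi - set_square (null_ideal chi))}"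

definition sine_subtraction ::
    "('a::semigroup_mult \<Rightarrow> complex) \<Rightarrow> ('a \<Rightarrow> 'a) \<Rightarrow> ('a \<Rightarrow> complex) \<Rightarrow> ('a \<Rightarrow> complex) \<Rightarrow> bool" where
  "sine_subtraction \<mu> \<sigma> k l \<longleftrightarrow> (\<forall>x y. \<mu> y * k (x * \<sigma> y) = k x * l y - k y * l x)"

definition form1 :: "('a::semigroup_mult \<Rightarrow> complex) \<Rightarrow> ('a \<Rightarrow> complex) \<Rightarrow> bool" where
  "form1 k l \<longleftrightarrow> k \<noteq> (\<lambda>x. 0) \<and> (\<forall>x \<in> set_square UNIV. k x = 0) \<and> (\<exists>c. l = (\<lambda>x. c * k x))"

definition form2 ::
    "('a::semigroup_mult \<Rightarrow> complex) \<Rightarrow> ('a \<Rightarrow> 'a) \<Rightarrow> ('a \<Rightarrow> complex) \<Rightarrow> complex \<Rightarrow> complex \<Rightarrow>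
     ('a \<Rightarrow> complex) \<Rightarrow> ('a \<Rightarrow> complex) \<Rightarrow> bool" where
  "form2 \<mu> \<sigma> chi c1 c2 k l \<longleftrightarrow>
     multiplicative chi \<and> star \<mu> \<sigma> chi \<noteq> chi \<and> c1 \<noteq> 0 \<and>
     k = (\<lambda>x. c1 * ((chi x - star \<mu> \<sigma> chi x) / 2)) \<and>
     l = (\<lambda>x. (chi x + star \<mu> \<sigma> chi x) / 2 + c2 * ((chi x - star \<mu> \<sigma> chi x) / 2))"

text \<open>
  In \<open>form3\<close> the functions \<open>A\<close> and \<open>\<rho>\<close> are required not to vanish both, which is what
  \<open>k \<noteq> 0\<close> amounts to. Requiring \<open>A \<noteq> 0\<close> itself would lose solutions: let
  \<open>S = {1, p, q, 0}\<close> be the commutative monoid with \<open>xy = 0\<close> for all \<open>x, y \<noteq> 1\<close>, let \<open>\<sigma>\<close>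
  exchange \<open>p\<close> and \<open>q\<close>, let \<open>\<mu> = 1\<close>, let \<open>k(p) = 1\<close>, \<open>k(q) = -1\<close>, \<open>k(1) = k(0) = 0\<close>, and
  let \<open>l\<close> be \<open>1\<close> at the identity and \<open>0\<close> elsewhere. Then \<open>(k, l)\<close> is a solution, which is
  not of the first two forms, and of the third one only with \<open>chi = l\<close>, where
  \<open>S - null_ideal chi = {1}\<close> and hence \<open>A = 0\<close>.
\<close>

definition form3 ::
    "('a::semigroup_mult \<Rightarrow> complex) \<Rightarrow> ('a \<Rightarrow> 'a) \<Rightarrow> ('a \<Rightarrow> complex) \<Rightarrow> ('a \<Rightarrow> complex) \<Rightarrow>
     ('a \<Rightarrow> complex) \<Rightarrow> complex \<Rightarrow> ('a \<Rightarrow> complex) \<Rightarrow> ('a \<Rightarrow> complex) \<Rightarrow> bool" where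
  "form3 \<mu> \<sigma> chi A \<rho> c k l \<longleftrightarrow>
     multiplicative chi \<and> chi \<noteq> (\<lambda>x. 0) \<and>
     additive_on (- null_ideal chi) A \<and>
     ((\<exists>x \<in> - null_ideal chi. A x \<noteq> 0) \<or> (\<exists>p \<in> P_set chi. \<rho> p \<noteq> 0)) \<and>
     star \<mu> \<sigma> chi = chi \<and>
     (\<forall>x \<in> - null_ideal chi. A (\<sigma> x) = - A x) \<and>
     (\<forall>p \<in> P_set chi. star \<mu> \<sigma> \<rho> p = - \<rho> p) \<and>
     (\<forall>x \<in> - null_ideal chi. k x = chi x * A x \<and> l x = chi x * (1 + c * A x)) \<and>
     (\<forall>x \<in> null_ideal chi - P_set chi. k x = 0 \<and> l x = 0) \<and>
     (\<forall>p \<in> P_set chi. k p = \<rho> p \<and> l p = c * \<rho> p)"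

definition condition_I :: "('a::semigroup_mult \<Rightarrow> complex) \<Rightarrow> ('a \<Rightarrow> complex) \<Rightarrow> bool" where
  "condition_I chi \<rho> \<longleftrightarrow>
     (\<forall>p \<in> P_set chi. \<forall>u \<in> - null_ideal chi. \<forall>v \<in> - null_ideal chi.
        (u * p \<in> P_set chi \<and> \<rho> (u * p) = \<rho> p * chi u) \<and>
        (p * v \<in> P_set chi \<and> \<rho> (p * v) = \<rho> p * chi v) \<and>
        (u * p * v \<in> P_set chi \<and> \<rho> (u * p * v) = \<rho> p * chi (u * v)))"

definition condition_II :: "('a::semigroup_mult \<Rightarrow> complex) \<Rightarrow> ('a \<Rightarrow> complex) \<Rightarrow> bool" where
  "condition_II chi k \<longleftrightarrow>
     (\<forall>x \<in> - null_ideal chi. \<forall>y \<in> null_ideal chi - P_set chi. k (x * y) = 0 \<and> k (y * x) = 0)"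

text \<open>
  The topology on \<open>S\<close> is an explicit parameter, so that the purely algebraic statements need no
  topology on the type.
\<close>

definition topological_semigroup :: "'a::semigroup_mult topology \<Rightarrow> bool" where
  "topological_semigroup X \<longleftrightarrow>
     topspace X = UNIV \<and> continuous_map (prod_topology X X) X (\<lambda>(x, y). x * y)"

end

theory Submission
  imports Defs
begin

text \<open>
  With \<open>f*\<close> for \<open>star \<mu> \<sigma> f\<close>, the equation reads \<open>k(xy) = k(x) l*(y) - k*(y) l(x)\<close>. If \<open>k\<close> and \<open>l\<close>
  are dependent, the right-hand side of the original equation vanishes, which gives the first form.
  Otherwise \<open>k*(xy) = -k(yx)\<close> makes \<open>k\<close> invariant under cyclic shifts of triple products, and this
  forces \<open>k* = -k\<close> everywhere. Then \<open>l = g + c k\<close> with \<open>g* = g\<close>, and \<open>(k, g)\<close> satisfies the sine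
  addition law \<open>k(xy) = k(x) g(y) + g(x) k(y)\<close>. Associativity yields
  \<open>g(xy) = g(x) g(y) + a\<^sup>2 k(x) k(y)\<close>; for \<open>a \<noteq> 0\<close> the functions \<open>g \<plusminus> a k\<close> are multiplicative and
  interchanged by the star operation, for \<open>a = 0\<close> the function \<open>g\<close> itself is multiplicative.
\<close>

section \<open>The star operation and the equation rewritten for plain products\<close>

locale involution_weight =
  fixes \<sigma> :: "'a::semigroup_mult \<Rightarrow> 'a" and \<mu> :: "'a \<Rightarrow> complex"
  assumes involutive: "involutive_automorphism \<sigma>"
    and weight_multiplicative: "multiplicative \<mu>"
    and weight_norm: "\<forall>x. \<mu> (x * \<sigma> x) = 1"
begin

abbreviation st :: "('a \<Rightarrow> complex) \<Rightarrow> 'a \<Rightarrow> complex" where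
  "st \<equiv> star \<mu> \<sigma>"

lemma sigma_mult: "\<sigma> (x * y) = \<sigma> x * \<sigma> y"
  using involutive by (simp add: involutive_automorphism_def)

lemma sigma_sigma [simp]: "\<sigma> (\<sigma> x) = x"
  using involutive by (simp add: involutive_automorphism_def)

lemma mu_mult: "\<mu> (x * y) = \<mu> x * \<mu> y"
  using weight_multiplicative by (simp add: multiplicative_def)

lemma mu_sigma: "\<mu> x * \<mu> (\<sigma> x) = 1"
  using weight_norm by (simp add: mu_mult)

lemma mu_nonzero [simp]: "\<mu> x \<noteq> 0"
  using mu_sigma[of x] by auto

lemma star_star [simp]: "st (st f) = f"
  by (rule ext) (simp add: star_def mult.assoc[symmetric] mu_sigma)

lemma star_multiplicative:
  assumes "multiplicative chi"
  shows "multiplicative (st chi)"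
  using assms by (simp add: multiplicative_def star_def mu_mult sigma_mult)

text \<open>Replacing \<open>y\<close> by \<open>\<sigma> y\<close> and cancelling with
  \<open>\<mu> y * \<mu> (\<sigma> y) = 1\<close> removes \<open>\<sigma>\<close> from the argument
  of \<open>k\<close>, so that associativity can be applied to \<open>k\<close> directly.\<close>

lemma sine_subtraction_iff:
  "sine_subtraction \<mu> \<sigma> k l \<longleftrightarrow> (\<forall>x y. k (x * y) = k x * st l y - st k y * l x)"
proof
  assume eq: "sine_subtraction \<mu> \<sigma> k l"
  show "\<forall>x y. k (x * y) = k x * st l y - st k y * l x"
  proof (intro allI)
    fix x y
    have "\<mu> (\<sigma> y) * k (x * y) = k x * l (\<sigma> y) - k (\<sigma> y) * l x"
      using eq[unfolded sine_subtraction_def, rule_format, of "\<sigma> y" x] by simp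
    then have "\<mu> y * \<mu> (\<sigma> y) * k (x * y) = \<mu> y * (k x * l (\<sigma> y) - k (\<sigma> y) * l x)"
      by simp
    then show "k (x * y) = k x * st l y - st k y * l x"
      by (simp add: mu_sigma star_def algebra_simps)
  qed
next
  assume eq: "\<forall>x y. k (x * y) = k x * st l y - st k y * l x"
  show "sine_subtraction \<mu> \<sigma> k l"
    unfolding sine_subtraction_def
  proof (intro allI)
    fix x y
    have "\<mu> y * k (x * \<sigma> y) = \<mu> y * (k x * st l (\<sigma> y) - st k (\<sigma> y) * l x)"
      using eq by simp
    also have "\<dots> = (\<mu> y * \<mu> (\<sigma> y)) * (k x * l y - k y * l x)"
      by (simp add: star_def algebra_simps)
    finally show "\<mu> y * k (x * \<sigma> y) = k x * l y - k y * l x"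
      by (simp add: mu_sigma)
  qed
qed

section \<open>Oddness of \<open>k\<close> under the star operation\<close>

text \<open>The star operation exchanges \<open>k\<close> with \<open>st k\<close> and
  \<open>l\<close> with \<open>st l\<close>, which turns the right-hand side at
  \<open>(x, y)\<close> into minus the right-hand side at \<open>(y, x)\<close>.\<close>

lemma star_k_mult:
  assumes eq: "\<And>x y. k (x * y) = k x * st l y - st k y * l x"
  shows "st k (x * y) = - k (y * x)"
proof -
  have "st k (x * y) = \<mu> x * \<mu> y * (k (\<sigma> x) * (\<mu> (\<sigma> y) * l y) - \<mu> (\<sigma> y) * k y * l (\<sigma> x))"
    using eq[of "\<sigma> x" "\<sigma> y"] by (simp add: star_def sigma_mult mu_mult)
  also have "\<dots> = (\<mu> y * \<mu> (\<sigma> y)) * (\<mu> x * k (\<sigma> x) * l y - k y * (\<mu> x * l (\<sigma> x)))"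
    by (simp add: algebra_simps)
  also have "\<dots> = - k (y * x)"
    using eq[of y x] by (simp add: mu_sigma star_def)
  finally show ?thesis .
qed

lemma star_eq_uminus:
  assumes eq: "\<And>x y. k (x * y) = k x * st l y - st k y * l x"
    and indep: "\<And>a b. \<forall>x. a * k x + b * l x = 0 \<Longrightarrow> a = 0 \<and> b = 0"
  shows "st k x = - k x"
proof -
  define K L where "K = st k" and "L = st l"
  note eq = eq[folded K_def L_def]
  have K_mult: "K (x * y) = - k (y * x)" for x y
    unfolding K_def by (rule star_k_mult[OF assms(1)])
  \<comment> \<open>Splitting one triple product at either of its two places evaluates
    \<open>K\<close> in two ways, which differ by a cyclic shift of the argument of
    \<open>k\<close>.\<close>
  have cyclic: "k (x * (y * z)) = k (y * z * x)" for x y z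
    using K_mult[of "y * z" x] K_mult[of y "z * x"] K_mult[of z "x * y"] K_mult[of "z * x" y]
    by (simp add: mult.assoc)
  have K_triple: "K (x * y * z) = - k (x * y * z)" for x y z
    using K_mult[of "x * y" z] cyclic[of z x y] by simp
  \<comment> \<open>If \<open>k\<close> vanished on all triple products, independence would make it
    vanish on products of two elements, and then everywhere.\<close>
  have "\<exists>a b c. k (a * b * c) \<noteq> 0"
  proof (rule ccontr)
    assume "\<not> ?thesis"
    then have zero: "k (a * b * c) = 0" for a b c
      by blast
    have "K (y * z) = 0" for y z
    proof -
      have "\<forall>x. L (y * z) * k x + (- K (y * z)) * l x = 0"
        using eq[of _ "y * z"] zero by (simp add: algebra_simps flip: mult.assoc)
      from indep[OF this] show ?thesis
        by simp
    qed
    then have zero2: "k (x * y) = 0" for x y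
      using K_mult[of y x] by simp
    have "K y = 0" for y
    proof -
      have "\<forall>x. L y * k x + (- K y) * l x = 0"
        using eq[of _ y] zero2 by (simp add: algebra_simps)
      from indep[OF this] show ?thesis
        by simp
    qed
    then have "k x = 0" for x
      using star_star[of k] K_def by (metis star_def mult_zero_right)
    then show False
      using indep[of 1 0] by simp
  qed
  then obtain a b c where w0: "k (a * b * c) \<noteq> 0"
    by blast
  \<comment> \<open>These are the coefficients that appear when the identity \<open>triple\<close>
    below, taken at \<open>a\<close>, \<open>b\<close>, \<open>c\<close>, is divided by
    \<open>k (a * b * c)\<close>.\<close>
  define p where "p = L (a * b * c) / k (a * b * c)"
  define q where "q = l (a * b * c) / k (a * b * c)"
  \<comment> \<open>Both sides come from \<open>k (x * w) = k (w * x)\<close> with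
    \<open>w = u * v * w'\<close>, expanded by \<open>eq\<close> in each order, where
    \<open>K w = - k w\<close>.\<close>
  have triple: "k x * L (u * v * w) + K x * l (u * v * w) = k (u * v * w) * (L x - l x)"
    for x u v w
    using eq[of x "u * v * w"] eq[of "u * v * w" x] cyclic[of x "u * v" w] K_triple[of u v w]
    by (simp add: algebra_simps)
  have L_minus_l: "L x - l x = p * k x + q * K x" for x
    using triple[of x a b c] w0 by (simp add: p_def q_def field_simps)
  show ?thesis
  proof (rule ccontr)
    assume "st k x \<noteq> - k x"
    then have x: "k x + K x \<noteq> 0"
      by (metis K_def add_eq_0_iff)
    \<comment> \<open>\<open>L - l\<close> is odd under the star operation, hence so is \<open>p k + q K\<close>; so \<open>q = -p\<close>.\<close>
    have "l y - L y = p * K y + q * k y" for y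
    proof -
      have "\<mu> y * (L (\<sigma> y) - l (\<sigma> y)) = \<mu> y * (p * k (\<sigma> y) + q * K (\<sigma> y))"
        by (simp add: L_minus_l)
      moreover have "\<mu> y * L (\<sigma> y) = l y" "\<mu> y * K (\<sigma> y) = k y"
        "\<mu> y * l (\<sigma> y) = L y" "\<mu> y * k (\<sigma> y) = K y"
        using star_star[of l] star_star[of k] by (metis K_def L_def star_def)+
      ultimately show ?thesis
        by (simp add: algebra_simps)
    qed
    from this[of x] L_minus_l[of x] have "(p + q) * (k x + K x) = 0"
      by algebra
    with x have q: "q = - p"
      by (simp add: add_eq_0_iff)
    \<comment> \<open>On triple products \<open>K = - k\<close>, so \<open>p * k + q * K\<close>
      becomes \<open>2 * p * k\<close>. Inserting this into \<open>triple\<close> leaves a product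
      with the non-zero factor \<open>k x + K x\<close>.\<close>
    have l_triple: "l (u * v * w) = - p * k (u * v * w)"
      and L_triple: "L (u * v * w) = p * k (u * v * w)" for u v w
    proof -
      have diff: "L (u * v * w) - l (u * v * w) = 2 * p * k (u * v * w)"
        using L_minus_l[of "u * v * w"] K_triple[of u v w] q by (simp add: algebra_simps)
      have "(k x + K x) * (l (u * v * w) + p * k (u * v * w)) = 0"
        using triple[of x u v w] L_minus_l[of x] q diff by algebra
      with x show "l (u * v * w) = - p * k (u * v * w)"
        by (simp add: add_eq_0_iff)
      with diff show "L (u * v * w) = p * k (u * v * w)"
        by (simp add: algebra_simps)
    qed
    \<comment> \<open>Left multiplication by \<open>y\<close> scales \<open>k\<close> on triple
      products by the factor \<open>m y\<close>; associativity then makes \<open>m\<close>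
      multiplicative.\<close>
    define m where "m y = l y + p * k y" for y
    have k_m: "k (y * (u * v * w)) = k (u * v * w) * m y" for y u v w
      using eq[of y "u * v * w"] K_triple[of u v w] L_triple[of u v w]
      by (simp add: m_def algebra_simps)
    have m_mult: "m (y * z) = m y * m z" for y z
    proof -
      have "k (a * b * c) * m (y * z) = k (y * (z * a * b * c))"
        using k_m[of "y * z" a b c] by (simp add: mult.assoc)
      also have "\<dots> = k (z * a * b * c) * m y"
        using k_m[of y "z * a" b c] by (simp add: mult.assoc)
      also have "k (z * a * b * c) = k (a * b * c) * m z"
        using k_m[of z a b c] by (simp add: mult.assoc)
      finally show ?thesis
        using w0 by simp
    qed
    \<comment> \<open>The cube of \<open>m y\<close> is the value of \<open>m\<close> at a triple
      product, which is zero by \<open>l_triple\<close>. Thus \<open>l = - p * k\<close>, against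
      independence.\<close>
    have "m y = 0" for y
    proof -
      have "m y * m y * m y = m (y * y * y)"
        by (simp add: m_mult)
      also have "\<dots> = 0"
        by (simp add: m_def l_triple)
      finally show ?thesis
        by simp
    qed
    then show False
      using indep[of p 1] by (simp add: m_def algebra_simps)
  qed
qed

end

section \<open>The sine addition law\<close>

text \<open>Write \<open>D x y = g (x * y) - g x * g y\<close>. Expanding
  \<open>k (x * y * z)\<close> in both groupings gives \<open>k z * D x y = k x * D y z\<close>. Two
  uses of this move both arguments of \<open>D\<close> to a fixed \<open>z\<close> with
  \<open>k z \<noteq> 0\<close>, so \<open>D x y\<close> is a constant times
  \<open>k x * k y\<close>.\<close>

lemma sine_addition_cosine:
  fixes k g :: "'a::semigroup_mult \<Rightarrow> complex"
  assumes eq: "\<And>x y. k (x * y) = k x * g y + g x * k y"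
    and "k \<noteq> (\<lambda>x. 0)"
  obtains d where "\<And>x y. g (x * y) = g x * g y + d * k x * k y"
proof -
  have assoc: "k z * (g (x * y) - g x * g y) = k x * (g (y * z) - g y * g z)" for x y z
  proof -
    have "k (x * y) * g z + g (x * y) * k z = k x * g (y * z) + g x * k (y * z)"
      using eq[of "x * y" z] eq[of x "y * z"] by (simp add: mult.assoc)
    then show ?thesis
      unfolding eq[of x y] eq[of y z] by algebra
  qed
  obtain z where z: "k z \<noteq> 0"
    using assms(2) by blast
  define d where "d = (g (z * z) - g z * g z) / (k z * k z)"
  have "g (x * y) = g x * g y + d * k x * k y" for x y
  proof -
    have "k z * (k z * (g (x * y) - g x * g y)) = k x * (k z * (g (y * z) - g y * g z))"
      using assoc[of z x y] by algebra
    also have "\<dots> = k x * (k y * (g (z * z) - g z * g z))"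
      using assoc[of z y z] by simp
    also have "\<dots> = k z * (k z * (d * k x * k y))"
      using z by (simp add: d_def)
    finally have "g (x * y) - g x * g y = d * k x * k y"
      using z by simp
    then show ?thesis
      by (simp add: algebra_simps)
  qed
  then show thesis
    by (rule that)
qed

section \<open>Continuity of multiples and quotients\<close>

lemma continuous_map_mult_const:
  fixes f :: "'a \<Rightarrow> 'b::real_normed_algebra"
  assumes "continuous_map X euclidean f"
  shows "continuous_map X euclidean (\<lambda>x. c * f x)"
  using assms by (simp add: continuous_map_atin tendsto_mult)

lemma continuous_map_quotient:
  fixes f g :: "'a \<Rightarrow> 'b::real_normed_field"
  assumes "continuous_map X euclidean f" and "continuous_map X euclidean g"
    and "\<And>x. x \<in> topspace X \<Longrightarrow> g x \<noteq> 0"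
  shows "continuous_map X euclidean (\<lambda>x. f x / g x)"
  using assms by (simp add: continuous_map_atin tendsto_divide)

section \<open>The null ideal and the set \<open>P_set chi\<close>\<close>

lemma null_ideal_mult:
  assumes "multiplicative chi"
  shows "x * y \<in> null_ideal chi \<longleftrightarrow> x \<in> null_ideal chi \<or> y \<in> null_ideal chi"
  using assms by (auto simp: null_ideal_def multiplicative_def)

text \<open>Outer factors of \<open>u * p\<close> are absorbed:
  \<open>x * (u * p) = (x * u) * p\<close>, and \<open>x * u\<close> again lies outside the null
  ideal. So the conditions on \<open>u * p\<close> are instances of those on \<open>p\<close>;
  likewise on the right.\<close>

lemma P_set_mult:
  assumes chi: "multiplicative chi"
    and p: "p \<in> P_set chi" and u: "u \<notin> null_ideal chi" and v: "v \<notin> null_ideal chi"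
  shows "u * p \<in> P_set chi" and "p * v \<in> P_set chi" and "u * p * v \<in> P_set chi"
proof -
  have step: "u * p \<in> P_set chi \<and> p * u \<in> P_set chi"
    if "p \<in> P_set chi" "u \<notin> null_ideal chi" for p u
  proof -
    have *: "x * p \<in> null_ideal chi - set_square (null_ideal chi)"
        "p * y \<in> null_ideal chi - set_square (null_ideal chi)"
        "x * p * y \<in> null_ideal chi - set_square (null_ideal chi)"
      if "x \<notin> null_ideal chi" "y \<notin> null_ideal chi" for x y
      using \<open>p \<in> P_set chi\<close> that unfolding P_set_def by blast+
    have prod: "x * y \<notin> null_ideal chi" if "x \<notin> null_ideal chi" "y \<notin> null_ideal chi" for x y
      using that null_ideal_mult[OF chi] by blast
    have "u * p \<in> P_set chi"
      unfolding P_set_def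
      using *(1)[OF that(2) that(2)] *(1)[OF prod[OF _ that(2)]] *(3)[OF that(2)]
        *(3)[OF prod[OF _ that(2)]]
      by (simp add: mult.assoc)
    moreover have "p * u \<in> P_set chi"
      unfolding P_set_def
      using *(2)[OF that(2) that(2)] *(2)[OF _ prod[OF that(2)]] *(3)[OF _ that(2)]
        *(3)[OF _ prod[OF that(2)]]
      by (simp add: mult.assoc)
    ultimately show ?thesis ..
  qed
  from step[OF p u] show "u * p \<in> P_set chi" ..
  from step[OF p v] show "p * v \<in> P_set chi" ..
  from step[OF p u] step[of "u * p" v] v show "u * p * v \<in> P_set chi"
    by blast
qed

text \<open>On the square of the null ideal \<open>k\<close> is zero, while multiplying a null
  element by some \<open>u\<close> outside the ideal only scales \<open>k\<close> by
  \<open>chi u \<noteq> 0\<close>. In contrapositive form, \<open>k\<close> vanishes on the null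
  ideal outside \<open>P_set chi\<close>.\<close>

lemma P_setI_nonzero:
  assumes chi: "multiplicative chi"
    and eq: "\<And>x y. k (x * y) = k x * chi y + chi x * k y"
    and p: "p \<in> null_ideal chi" and nz: "k p \<noteq> 0"
  shows "p \<in> P_set chi"
proof -
  have in_diff: "x \<in> null_ideal chi - set_square (null_ideal chi)"
    if "x \<in> null_ideal chi" "k x \<noteq> 0" for x
    using that eq by (auto simp: set_square_def null_ideal_def)
  have left: "u * x \<in> null_ideal chi \<and> k (u * x) \<noteq> 0"
    and right: "x * u \<in> null_ideal chi \<and> k (x * u) \<noteq> 0"
    if "x \<in> null_ideal chi" "k x \<noteq> 0" "u \<notin> null_ideal chi" for x u
    using that chi eq by (auto simp: null_ideal_def multiplicative_def)
  show ?thesis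
    unfolding P_set_def using in_diff left right p nz by blast
qed

context involution_weight
begin

text \<open>Since \<open>\<mu>\<close> has no zeros, \<open>st chi = chi\<close> makes
  \<open>\<sigma>\<close> preserve the null ideal and its complement; being an involutive
  automorphism, it also preserves the square of the ideal.\<close>

lemma P_set_sigma:
  assumes "st chi = chi" "p \<in> P_set chi"
  shows "\<sigma> p \<in> P_set chi"
proof -
  have null: "\<sigma> x \<in> null_ideal chi \<longleftrightarrow> x \<in> null_ideal chi" for x
    using fun_cong[OF assms(1), of x] mu_nonzero[of x]
    by (metis (mono_tags) mem_Collect_eq mult_eq_0_iff null_ideal_def star_def)
  have square: "x \<in> set_square (null_ideal chi)" if "\<sigma> x \<in> set_square (null_ideal chi)" for x
  proof -
    from that obtain y z where "\<sigma> x = y * z" "y \<in> null_ideal chi" "z \<in> null_ideal chi"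
      unfolding set_square_def by blast
    then have "x = \<sigma> y * \<sigma> z" "\<sigma> y \<in> null_ideal chi" "\<sigma> z \<in> null_ideal chi"
      using null by (metis sigma_mult sigma_sigma)+
    then show ?thesis
      unfolding set_square_def by blast
  qed
  have diff: "\<sigma> x \<in> null_ideal chi - set_square (null_ideal chi)"
    if "x \<in> null_ideal chi - set_square (null_ideal chi)" for x
    using that null square by blast
  have *: "\<sigma> p \<in> null_ideal chi - set_square (null_ideal chi)"
    using assms(2) diff unfolding P_set_def by blast
  have "u * \<sigma> p \<in> null_ideal chi - set_square (null_ideal chi) \<and>
      \<sigma> p * v \<in> null_ideal chi - set_square (null_ideal chi) \<and>
      u * \<sigma> p * v \<in> null_ideal chi - set_square (null_ideal chi)"
    if "u \<in> - null_ideal chi" "v \<in> - null_ideal chi" for u v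
  proof -
    have "\<sigma> u \<in> - null_ideal chi" "\<sigma> v \<in> - null_ideal chi"
      using that null by auto
    then have "\<sigma> u * p \<in> null_ideal chi - set_square (null_ideal chi)"
        "p * \<sigma> v \<in> null_ideal chi - set_square (null_ideal chi)"
        "\<sigma> u * p * \<sigma> v \<in> null_ideal chi - set_square (null_ideal chi)"
      using assms(2) unfolding P_set_def by blast+
    from this[THEN diff] show ?thesis
      by (simp add: sigma_mult)
  qed
  with * show ?thesis
    unfolding P_set_def by blast
qed

section \<open>Classification of the solutions\<close>

lemma sine_addition_form3:
  assumes chi: "multiplicative chi" "chi \<noteq> (\<lambda>x. 0)" "st chi = chi"
    and eq: "\<And>x y. k (x * y) = k x * chi y + chi x * k y"
    and k: "k \<noteq> (\<lambda>x. 0)" and odd: "\<And>x. st k x = - k x"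
    and l: "\<And>x. l x = chi x + c * k x"
  shows "form3 \<mu> \<sigma> chi (\<lambda>x. k x / chi x) k c k l \<and> condition_I chi k \<and> condition_II chi k"
proof -
  have P: "k x = 0" if "x \<in> null_ideal chi - P_set chi" for x
    using that P_setI_nonzero[OF chi(1) eq] by blast
  have chi_sigma: "\<mu> x * chi (\<sigma> x) = chi x" and k_sigma: "\<mu> x * k (\<sigma> x) = - k x" for x
    using fun_cong[OF chi(3), of x] odd[of x] by (simp_all add: star_def)
  have P_null: "chi p = 0" if "p \<in> P_set chi" for p
    using that by (simp add: P_set_def null_ideal_def)
  obtain z where "k z \<noteq> 0"
    using k by blast
  \<comment> \<open>A point where \<open>k\<close> is non-zero lies outside the null ideal, giving
    \<open>A \<noteq> 0\<close>, or in \<open>P_set chi\<close>, giving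
    \<open>\<rho> \<noteq> 0\<close>.\<close>
  then have nontrivial: "(\<exists>x\<in>- null_ideal chi. k x / chi x \<noteq> 0) \<or> (\<exists>p\<in>P_set chi. k p \<noteq> 0)"
    using P[of z] by (cases "z \<in> null_ideal chi") (auto simp: null_ideal_def)
  have add: "additive_on (- null_ideal chi) (\<lambda>x. k x / chi x)"
    unfolding additive_on_def null_ideal_def
    using chi(1) eq by (auto simp: multiplicative_def field_simps)
  have A_sigma: "k (\<sigma> x) / chi (\<sigma> x) = - (k x / chi x)" if "x \<in> - null_ideal chi" for x
  proof -
    have "k (\<sigma> x) / chi (\<sigma> x) = (\<mu> x * k (\<sigma> x)) / (\<mu> x * chi (\<sigma> x))"
      by simp
    then show ?thesis
      by (simp add: chi_sigma k_sigma)
  qed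
  have "form3 \<mu> \<sigma> chi (\<lambda>x. k x / chi x) k c k l"
    unfolding form3_def
    using chi nontrivial add A_sigma odd P P_null l
    by (auto simp: null_ideal_def field_simps)
  moreover have "condition_I chi k"
    unfolding condition_I_def
    using P_set_mult[OF chi(1)] P_null chi(1) eq by (auto simp: multiplicative_def)
  moreover have "condition_II chi k"
    unfolding condition_II_def using P eq by (auto simp: null_ideal_def)
  ultimately show ?thesis
    by blast
qed

lemma sine_subtraction_cases:
  assumes k: "k \<noteq> (\<lambda>x. 0)" and sub: "sine_subtraction \<mu> \<sigma> k l"
  shows "form1 k l \<or> (\<exists>chi c1 c2. form2 \<mu> \<sigma> chi c1 c2 k l) \<or>
    (\<exists>chi A \<rho> c. form3 \<mu> \<sigma> chi A \<rho> c k l \<and> condition_I chi \<rho> \<and> condition_II chi k)"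
proof (cases "\<exists>c. l = (\<lambda>x. c * k x)")
  case True
  then obtain c where l: "l = (\<lambda>x. c * k x)"
    by blast
  have "k (x * y) = 0" for x y
    using sub[unfolded sine_subtraction_def l, rule_format, of "\<sigma> y" x] by simp
  then have "form1 k l"
    using k l unfolding form1_def set_square_def by blast
  then show ?thesis ..
next
  case False
  have eq: "k (x * y) = k x * st l y - st k y * l x" for x y
    using sub sine_subtraction_iff by blast
  \<comment> \<open>\<open>l\<close> is not a multiple of \<open>k\<close>, and \<open>k\<close> is
    not zero; together this is full linear independence.\<close>
  have indep: "a = 0 \<and> b = 0" if ab: "\<forall>x. a * k x + b * l x = 0" for a b
  proof -
    have "b = 0"
    proof (rule ccontr)
      assume "b \<noteq> 0"
      then have "l = (\<lambda>x. (- a / b) * k x)"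
        using ab by (auto simp: field_simps add_eq_0_iff2)
      with False show False
        by blast
    qed
    with ab k show ?thesis
      by auto
  qed
  have odd: "st k x = - k x" for x
    using star_eq_uminus[OF eq indep] by blast
  obtain z where z: "k z \<noteq> 0"
    using k by blast
  \<comment> \<open>\<open>k\<close> is central, so the odd part of \<open>l\<close> is proportional to \<open>k\<close>.\<close>
  have central: "k (x * y) = k (y * x)" for x y
    using star_k_mult[of k l x y, OF eq] odd[of "x * y"] by simp
  define c where "c = (l z - st l z) / (2 * k z)"
  have l_odd: "l x - st l x = 2 * c * k x" for x
  proof -
    have "k z * (l x - st l x) = k x * (l z - st l z)"
      using central[of x z] unfolding eq[of x z] eq[of z x] odd by (simp add: algebra_simps)
    moreover have "2 * c * k z = l z - st l z"
      using z by (simp add: c_def)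
    ultimately have "k z * (l x - st l x) = k z * (2 * c * k x)"
      by algebra
    then show ?thesis
      using z by simp
  qed
  \<comment> \<open>By \<open>l_odd\<close>, \<open>g\<close> is the even part
    \<open>(l + st l) / 2\<close>.\<close>
  define g where "g x = l x - c * k x" for x
  have star_g: "st g x = g x" for x
    using l_odd[of x] odd[of x] by (simp add: g_def star_def algebra_simps)
  have star_l: "st l x = g x - c * k x" and l: "l x = g x + c * k x" for x
    using l_odd[of x] by (simp_all add: g_def algebra_simps)
  have add: "k (x * y) = k x * g y + g x * k y" for x y
    unfolding eq[of x y] odd star_l l by (simp add: algebra_simps)
  obtain d where g_mult: "\<And>x y. g (x * y) = g x * g y + d * k x * k y"
    using sine_addition_cosine[OF add k] by blast
  show ?thesis
  proof (cases "d = 0")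
    case True
    have "multiplicative g" "st g = g"
      using g_mult True star_g by (auto simp: multiplicative_def)
    moreover have "g \<noteq> (\<lambda>x. 0)"
    proof
      assume "g = (\<lambda>x. 0)"
      then have "l = (\<lambda>x. c * k x)"
        by (intro ext) (simp add: l)
      with False show False
        by blast
    qed
    ultimately show ?thesis
      using sine_addition_form3[of g k l c] add k odd l by blast
  next
    case False
    \<comment> \<open>With \<open>a * a = d\<close>, the addition formulas for \<open>g\<close> and
      \<open>k\<close> combine so that \<open>g + a * k\<close> is multiplicative. The star
      operation sends it to \<open>g - a * k\<close>, so half the difference of the two is
      \<open>a * k\<close>; hence the constants \<open>1 / a\<close> and
      \<open>c / a\<close>.\<close>
    define a where "a = csqrt d"
    have a: "a \<noteq> 0" "d = a * a"
      using False power2_csqrt[of d] by (simp_all add: a_def power2_eq_square)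
    define chi where "chi x = g x + a * k x" for x
    have star_chi: "st chi x = g x - a * k x" for x
      using star_g[of x] odd[of x] by (simp add: chi_def star_def algebra_simps)
    have "multiplicative chi"
      by (simp add: multiplicative_def chi_def g_mult add a(2) algebra_simps)
    moreover have "st chi \<noteq> chi"
    proof
      assume "st chi = chi"
      from fun_cong[OF this, of z] star_chi[of z] have "2 * (a * k z) = 0"
        by (simp add: chi_def algebra_simps)
      with a z show False
        by simp
    qed
    moreover have "k = (\<lambda>x. 1 / a * ((chi x - st chi x) / 2))"
      "l = (\<lambda>x. (chi x + st chi x) / 2 + c / a * ((chi x - st chi x) / 2))"
      using a(1) l unfolding star_chi by (auto simp: chi_def)
    ultimately have "form2 \<mu> \<sigma> chi (1 / a) (c / a) k l"
      using a(1) by (simp add: form2_def)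
    then show ?thesis
      by blast
  qed
qed

section \<open>The three forms solve the equation\<close>

lemma form1_sine_subtraction:
  assumes "form1 k l"
  shows "sine_subtraction \<mu> \<sigma> k l"
  using assms by (fastforce simp: form1_def set_square_def sine_subtraction_def)

lemma form2_sine_subtraction:
  assumes "form2 \<mu> \<sigma> chi c1 c2 k l"
  shows "sine_subtraction \<mu> \<sigma> k l"
proof -
  from assms have chi: "multiplicative chi"
    and k: "\<And>x. k x = c1 * ((chi x - st chi x) / 2)"
    and l: "\<And>x. l x = (chi x + st chi x) / 2 + c2 * ((chi x - st chi x) / 2)"
    by (simp_all add: form2_def)
  have star_k: "st k x = - k x" for x
  proof -
    have "st k x = c1 * ((st chi x - st (st chi) x) / 2)"
      unfolding star_def[of \<mu> \<sigma> k] star_def[of \<mu> \<sigma> chi] star_def[of \<mu> \<sigma> "st chi"] k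
      by (simp add: star_def algebra_simps)
    also have "\<dots> = - k x"
      by (simp add: k[of x] field_simps)
    finally show ?thesis .
  qed
  have star_l: "st l x = (chi x + st chi x) / 2 - c2 * ((chi x - st chi x) / 2)" for x
  proof -
    have "st l x = (st chi x + st (st chi) x) / 2 + c2 * ((st chi x - st (st chi) x) / 2)"
      by (simp add: star_def l field_simps del: star_star)
    also have "\<dots> = (chi x + st chi x) / 2 - c2 * ((chi x - st chi x) / 2)"
      by (simp add: field_simps)
    finally show ?thesis .
  qed
  have "chi (x * y) = chi x * chi y" "st chi (x * y) = st chi x * st chi y" for x y
    using chi star_multiplicative[OF chi] by (simp_all add: multiplicative_def)
  then show ?thesis
    unfolding sine_subtraction_iff star_k star_l unfolding k l by (simp add: field_simps)
qed

text \<open>Since \<open>chi\<close> is zero on the null ideal, the three cases for \<open>l\<close>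
  merge into one formula, and \<open>A\<close> and \<open>\<rho>\<close> need only be followed
  through \<open>k\<close>.\<close>

lemma form3_l:
  assumes "form3 \<mu> \<sigma> chi A \<rho> c k l"
  shows "l x = chi x + c * k x"
proof -
  consider "x \<in> - null_ideal chi" | "x \<in> null_ideal chi - P_set chi" | "x \<in> P_set chi"
    by blast
  then show ?thesis
    using assms unfolding form3_def
    by cases (auto simp: null_ideal_def P_set_def algebra_simps)
qed

text \<open>With \<open>st k = - k\<close> and \<open>l = chi + c * k\<close>, the terms in
  \<open>c\<close> cancel and the sine addition law with cosine \<open>chi\<close> remains. It is
  checked according to which factors lie in the null ideal.\<close>

lemma form3_sine_subtraction:
  assumes form: "form3 \<mu> \<sigma> chi A \<rho> c k l"
    and I: "condition_I chi \<rho>" and II: "condition_II chi k"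
  shows "sine_subtraction \<mu> \<sigma> k l"
proof -
  from form have chi: "multiplicative chi" and star_chi: "st chi = chi"
    and add: "additive_on (- null_ideal chi) A"
    and A_sigma: "\<And>x. x \<in> - null_ideal chi \<Longrightarrow> A (\<sigma> x) = - A x"
    and rho: "\<And>p. p \<in> P_set chi \<Longrightarrow> st \<rho> p = - \<rho> p"
    and k_A: "\<And>x. x \<in> - null_ideal chi \<Longrightarrow> k x = chi x * A x"
    and k_0: "\<And>x. x \<in> null_ideal chi - P_set chi \<Longrightarrow> k x = 0"
    and k_rho: "\<And>p. p \<in> P_set chi \<Longrightarrow> k p = \<rho> p"
    by (auto simp: form3_def)
  note l = form3_l[OF form]
  have chi_sigma: "\<mu> x * chi (\<sigma> x) = chi x" for x
    using fun_cong[OF star_chi, of x] by (simp add: star_def)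
  have null_sigma: "\<sigma> x \<in> null_ideal chi \<longleftrightarrow> x \<in> null_ideal chi" for x
    using chi_sigma[of x] mu_nonzero[of x] by (auto simp: null_ideal_def)
  have star_k: "st k x = - k x" for x
  proof -
    consider "x \<in> - null_ideal chi" | "x \<in> null_ideal chi - P_set chi" | "x \<in> P_set chi"
      by blast
    then show ?thesis
    proof cases
      case 1
      then have "st k x = (\<mu> x * chi (\<sigma> x)) * A (\<sigma> x)"
        using null_sigma[of x] by (simp add: star_def k_A)
      with 1 show ?thesis
        by (simp add: chi_sigma A_sigma k_A)
    next
      case 2
      then have "\<sigma> x \<in> null_ideal chi - P_set chi"
        using null_sigma[of x] P_set_sigma[OF star_chi, of "\<sigma> x"] by auto
      with 2 show ?thesis
        by (simp add: star_def k_0)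
    next
      case 3
      with P_set_sigma[OF star_chi 3] rho[OF 3] show ?thesis
        by (simp add: star_def k_rho)
    qed
  qed
  have star_l: "st l x = chi x - c * k x" for x
  proof -
    have "st l x = \<mu> x * chi (\<sigma> x) + c * st k x"
      by (simp add: star_def l algebra_simps)
    then show ?thesis
      by (simp add: chi_sigma star_k)
  qed
  \<comment> \<open>Condition (I) settles \<open>x\<close> in \<open>P_set chi\<close>, condition
    (II) the rest of the null ideal.\<close>
  have k_left: "k (u * x) = chi u * k x" and k_right: "k (x * u) = k x * chi u"
    if "u \<notin> null_ideal chi" "x \<in> null_ideal chi" for u x
  proof -
    have "k (u * x) = chi u * k x \<and> k (x * u) = k x * chi u"
    proof (cases "x \<in> P_set chi")
      case True
      with that I have "u * x \<in> P_set chi" "\<rho> (u * x) = \<rho> x * chi u"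
        "x * u \<in> P_set chi" "\<rho> (x * u) = \<rho> x * chi u"
        unfolding condition_I_def by blast+
      with True show ?thesis
        by (simp add: k_rho)
    next
      case False
      with that II have "k (u * x) = 0" "k (x * u) = 0"
        unfolding condition_II_def by blast+
      with False that show ?thesis
        by (simp add: k_0)
    qed
    then show "k (u * x) = chi u * k x" and "k (x * u) = k x * chi u"
      by blast+
  qed
  have "k (x * y) = k x * chi y + chi x * k y" for x y
  proof (cases "x \<in> null_ideal chi"; cases "y \<in> null_ideal chi")
    \<comment> \<open>The product lies in the square of the null ideal, which
      \<open>P_set chi\<close> avoids, so all terms are zero.\<close>
    assume "x \<in> null_ideal chi" "y \<in> null_ideal chi"
    then have "x * y \<in> null_ideal chi - P_set chi"
      using null_ideal_mult[OF chi, of x y] unfolding P_set_def set_square_def by blast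
    with \<open>x \<in> null_ideal chi\<close> \<open>y \<in> null_ideal chi\<close> show ?thesis
      by (simp add: k_0 null_ideal_def)
  next
    assume "x \<in> null_ideal chi" "y \<notin> null_ideal chi"
    then show ?thesis
      using k_right[of y x] by (simp add: null_ideal_def)
  next
    assume "x \<notin> null_ideal chi" "y \<in> null_ideal chi"
    then show ?thesis
      using k_left[of x y] by (simp add: null_ideal_def)
  next
    assume x: "x \<notin> null_ideal chi" and y: "y \<notin> null_ideal chi"
    then have "A (x * y) = A x + A y" "x * y \<in> - null_ideal chi"
      using add null_ideal_mult[OF chi, of x y] unfolding additive_on_def by blast+
    with x y chi show ?thesis
      by (simp add: k_A multiplicative_def algebra_simps)
  qed
  then show ?thesis
    unfolding sine_subtraction_iff star_k star_l unfolding l by (simp add: algebra_simps)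
qed

section \<open>Continuity of the functions in the forms\<close>

text \<open>For a fixed \<open>y\<close> with \<open>k y \<noteq> 0\<close> the equation can be
  solved for \<open>l x\<close>. Then \<open>\<sigma>\<close> enters only through the fixed element
  \<open>\<sigma> y\<close>, and \<open>x * \<sigma> y\<close> is continuous in
  \<open>x\<close>.\<close>

lemma continuous_sine_cosine:
  assumes X: "topological_semigroup X" and k: "continuous_map X euclidean k"
    and nz: "k \<noteq> (\<lambda>x. 0)" and sub: "sine_subtraction \<mu> \<sigma> k l"
  shows "continuous_map X euclidean l"
proof -
  obtain y where y: "k y \<noteq> 0"
    using nz by blast
  have top: "topspace X = UNIV" and mult: "continuous_map (prod_topology X X) X (\<lambda>(x, y). x * y)"
    using X by (simp_all add: topological_semigroup_def)
  have "continuous_map X (prod_topology X X) (\<lambda>x. (x, \<sigma> y))"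
    by (simp add: continuous_map_pairwise o_def top)
  from continuous_map_compose[OF this mult]
  have "continuous_map X X (\<lambda>x. x * \<sigma> y)"
    by (simp add: o_def)
  from continuous_map_compose[OF this k]
  have "continuous_map X euclidean (\<lambda>x. k (x * \<sigma> y))"
    by (simp add: o_def)
  with k have "continuous_map X euclidean (\<lambda>x. (l y / k y) * k x - (\<mu> y / k y) * k (x * \<sigma> y))"
    by (intro continuous_map_diff continuous_map_mult_const)
  moreover have "(l y / k y) * k x - (\<mu> y / k y) * k (x * \<sigma> y) = l x" for x
    using sub[unfolded sine_subtraction_def, rule_format, of y x] y by (simp add: field_simps)
  ultimately show ?thesis
    by (rule continuous_map_eq)
qed

lemma form2_continuous:
  assumes k: "continuous_map X euclidean k" and l: "continuous_map X euclidean l"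
    and form: "form2 \<mu> \<sigma> chi c1 c2 k l"
  shows "continuous_map X euclidean chi" and "continuous_map X euclidean (st chi)"
proof -
  \<comment> \<open>The formulas for \<open>k\<close> and \<open>l\<close> form a linear system in
    \<open>chi\<close> and \<open>st chi\<close>, solvable because
    \<open>c1 \<noteq> 0\<close>.\<close>
  from form have "chi x = l x + (1 - c2) / c1 * k x" "st chi x = l x + (- 1 - c2) / c1 * k x" for x
    by (simp_all add: form2_def field_simps)
  then have eqs: "chi = (\<lambda>x. l x + (1 - c2) / c1 * k x)"
    "st chi = (\<lambda>x. l x + (- 1 - c2) / c1 * k x)"
    by blast+
  show "continuous_map X euclidean chi"
    unfolding eqs(1) using k l by (intro continuous_map_add continuous_map_mult_const)
  show "continuous_map X euclidean (st chi)"
    unfolding eqs(2) using k l by (intro continuous_map_add continuous_map_mult_const)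
qed

lemma form3_continuous:
  assumes k: "continuous_map X euclidean k" and l: "continuous_map X euclidean l"
    and form: "form3 \<mu> \<sigma> chi A \<rho> c k l"
  shows "continuous_map X euclidean chi" and "continuous_map X euclidean (st chi)"
    and "continuous_map (subtopology X (- null_ideal chi)) euclidean A"
    and "continuous_map (subtopology X (P_set chi)) euclidean \<rho>"
proof -
  have chi_eq: "chi = (\<lambda>x. l x - c * k x)"
    using form3_l[OF form] by (auto simp: algebra_simps)
  show chi: "continuous_map X euclidean chi"
    by (subst chi_eq) (intro continuous_map_diff continuous_map_mult_const k l)
  then show "continuous_map X euclidean (st chi)"
    using form by (simp add: form3_def)
  \<comment> \<open>\<open>A\<close> is recovered as \<open>k / chi\<close>, whose denominator has
    no zeros outside the null ideal.\<close>
  have "continuous_map (subtopology X (- null_ideal chi)) euclidean (\<lambda>x. k x / chi x)"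
    using k chi
    by (intro continuous_map_quotient continuous_map_from_subtopology) (auto simp: null_ideal_def)
  then show "continuous_map (subtopology X (- null_ideal chi)) euclidean A"
    by (rule continuous_map_eq) (use form in \<open>auto simp: form3_def null_ideal_def\<close>)
  have "continuous_map (subtopology X (P_set chi)) euclidean k"
    using k by (rule continuous_map_from_subtopology)
  then show "continuous_map (subtopology X (P_set chi)) euclidean \<rho>"
    by (rule continuous_map_eq) (use form in \<open>auto simp: form3_def\<close>)
qed

end

theorem proposition3p2:
  fixes \<sigma> :: "'a::semigroup_mult \<Rightarrow> 'a" and \<mu> :: "'a \<Rightarrow> complex"
  assumes "involutive_automorphism \<sigma>"
    and "multiplicative \<mu>"
    and "\<forall>x. \<mu> (x * \<sigma> x) = 1"
  shows
    "(\<forall>k l. k \<noteq> (\<lambda>x. 0) \<and> sine_subtraction \<mu> \<sigma> k l \<longrightarrow>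
        form1 k l \<or>
        (\<exists>chi c1 c2. form2 \<mu> \<sigma> chi c1 c2 k l) \<or>
        (\<exists>chi A \<rho> c. form3 \<mu> \<sigma> chi A \<rho> c k l \<and> condition_I chi \<rho> \<and> condition_II chi k))
   \<and> (\<forall>k l. form1 k l \<longrightarrow> sine_subtraction \<mu> \<sigma> k l)
   \<and> (\<forall>chi c1 c2 k l. form2 \<mu> \<sigma> chi c1 c2 k l \<longrightarrow> sine_subtraction \<mu> \<sigma> k l)
   \<and> (\<forall>chi A \<rho> c k l. form3 \<mu> \<sigma> chi A \<rho> c k l \<and> condition_I chi \<rho> \<and> condition_II chi k \<and> abelian_fun k
        \<longrightarrow> sine_subtraction \<mu> \<sigma> k l)
   \<and> (\<forall>X k l. topological_semigroup X \<and> continuous_map X euclidean k \<and>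
        k \<noteq> (\<lambda>x. 0) \<and> sine_subtraction \<mu> \<sigma> k l \<longrightarrow>
        (\<forall>chi c1 c2. form2 \<mu> \<sigma> chi c1 c2 k l \<longrightarrow>
           continuous_map X euclidean chi \<and> continuous_map X euclidean (star \<mu> \<sigma> chi)) \<and>
        (\<forall>chi A \<rho> c. form3 \<mu> \<sigma> chi A \<rho> c k l \<and> condition_I chi \<rho> \<and> condition_II chi k \<longrightarrow>
           continuous_map X euclidean chi \<and> continuous_map X euclidean (star \<mu> \<sigma> chi) \<and>
           continuous_map (subtopology X (- null_ideal chi)) euclidean A \<and>
           continuous_map (subtopology X (P_set chi)) euclidean \<rho>))"
proof -
  interpret involution_weight \<sigma> \<mu>
    using assms by unfold_locales
  show ?thesis
  proof (intro conjI allI impI; (elim conjE)?)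
    fix k l
    assume "k \<noteq> (\<lambda>x. 0)" "sine_subtraction \<mu> \<sigma> k l"
    then show "form1 k l \<or> (\<exists>chi c1 c2. form2 \<mu> \<sigma> chi c1 c2 k l) \<or>
        (\<exists>chi A \<rho> c. form3 \<mu> \<sigma> chi A \<rho> c k l \<and> condition_I chi \<rho> \<and> condition_II chi k)"
      by (rule sine_subtraction_cases)
  \<comment> \<open>The continuity goals first obtain continuity of \<open>l\<close> from that of
    \<open>k\<close>, which the lemmas on the second and third forms take as a premise.\<close>
  qed (erule form1_sine_subtraction form2_sine_subtraction | rule form3_sine_subtraction, assumption+
    | rule form2_continuous form3_continuous, assumption, rule continuous_sine_cosine, assumption+)+
qed

end
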